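(* For all natural numbers $k\le n$, \[2^k\le \mathrm{suprank}(\mathrm{HD}_{\ge k}^n)\le 4^k.\]
   Context: $\mathrm{HD}_{\ge k}^n\in\{0,1\}^{2^n\times 2^n}$ has rows and columns indexed by $\{0,1\}^n$, with $\mathrm{HD}_{\ge k}^n(x,y)=1$ iff the Hamming distance between $x$ and $y$ (number of coordinates in which they differ) is at least $k$. The support-rank $\mathrm{suprank}(M)$ of a boolean matrix $M$ is the minimal rank of a real matrix $A$ of the same size such that for all $i,j$: $M(i,j)=0\iff A(i,j)=0$. *)

theory Defs
  imports "Jordan_Normal_Form.DL_Rank"
begin

text \<open>Points of \<open>{0,1}\<^sup>n\<close> are boolean lists of length \<open>n\<close>, and boolean matrices have type
  \<^typ>\<open>bool mat\<close>, with \<^const>\<open>True\<close> for the entry \<open>1\<close> and \<^const>\<open>False\<close> for the entry \<open>0\<close>.\<close>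

definition hamming_dist :: "'a list \<Rightarrow> 'a list \<Rightarrow> nat" where
  "hamming_dist x y = card {l. l < length x \<and> x ! l \<noteq> y ! l}"

text \<open>Matrix indices are natural numbers, so \<open>{0,1}\<^sup>n\<close> is enumerated by \<open>{..<2^n}\<close> through
  binary digits. Rank and support do not depend on the enumeration chosen.\<close>

definition cube_point :: "nat \<Rightarrow> nat \<Rightarrow> bool list" where
  "cube_point n i = map (bit i) [0..<n]"

lemma bij_betw_cube_point: "bij_betw (cube_point n) {..<2 ^ n} {x. length x = n}"
proof -
  have inj: "inj_on (cube_point n) {..<2 ^ n}"
  proof (rule inj_onI)
    fix i j :: nat
    assume ij: "i \<in> {..<2 ^ n}" "j \<in> {..<2 ^ n}" and "cube_point n i = cube_point n j"
    then have "bit i l = bit j l" if "l < n" for l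
      using that by (simp add: cube_point_def)
    then have "take_bit n i = take_bit n j"
      by (intro bit_eqI) (auto simp: bit_take_bit_iff)
    with ij show "i = j"
      by (metis lessThan_iff take_bit_nat_eq_self)
  qed
  have "finite {x :: bool list. length x = n}" "card {x :: bool list. length x = n} = 2 ^ n"
    using finite_lists_length_eq[of "UNIV :: bool set" n]
      card_lists_length_eq[of "UNIV :: bool set" n] by auto
  moreover have "card (cube_point n ` {..<2 ^ n}) = 2 ^ n"
    using card_image[OF inj] by simp
  moreover have "cube_point n ` {..<2 ^ n} \<subseteq> {x. length x = n}"
    by (auto simp: cube_point_def)
  ultimately have "cube_point n ` {..<2 ^ n} = {x. length x = n}"
    by (intro card_subset_eq) simp_all
  with inj show ?thesis
    unfolding bij_betw_def by blast
qed

definition HD_ge :: "nat \<Rightarrow> nat \<Rightarrow> bool mat" where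
  "HD_ge k n = mat (2 ^ n) (2 ^ n)
     (\<lambda>(i, j). k \<le> hamming_dist (cube_point n i) (cube_point n j))"

definition same_support :: "bool mat \<Rightarrow> real mat \<Rightarrow> bool" where
  "same_support M A \<longleftrightarrow> A \<in> carrier_mat (dim_row M) (dim_col M) \<and>
     (\<forall>i < dim_row M. \<forall>j < dim_col M. \<not> M $$ (i, j) \<longleftrightarrow> A $$ (i, j) = 0)"

text \<open>The first argument of \<^const>\<open>vec_space.rank\<close> is the dimension of the space that contains
  the columns, i.e. the number of rows.\<close>

definition suprank :: "bool mat \<Rightarrow> nat" where
  "suprank M = (LEAST r. \<exists>A. same_support M A \<and> vec_space.rank (dim_row M) A = r)"

lemma suprank_attained: "\<exists>A. same_support M A \<and> vec_space.rank (dim_row M) A = suprank M"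
proof -
  have "same_support M (map_mat of_bool M)"
    by (auto simp: same_support_def)
  then have "\<exists>r A. same_support M A \<and> vec_space.rank (dim_row M) A = r"
    by blast
  from LeastI_ex[OF this] show ?thesis
    unfolding suprank_def .
qed

end

theory Submission
  imports Defs
begin

text \<open>Lower bound: restricted to points that vanish outside the first \<open>k\<close> coordinates, the support
  is that of the permutation matrix of the antipodal map, so \<open>2\<^sup>k\<close> columns are independent.

  Upper bound: put \<open>v\<^sub>l = (1, l, \<dots>, l\<^bsup>k-1\<^esup>)\<close> and take
  \<open>A(x, y) = det (\<Sum>\<^sub>l c\<^sub>l (x\<^sub>l - y\<^sub>l) v\<^sub>l v\<^sub>l\<^sup>T)\<close>, a determinant of size \<open>k\<close>. The matrix is a
  difference of a matrix depending on \<open>x\<close> and one depending on \<open>y\<close>, so expanding over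
  complementary pairs of minors writes \<open>A\<close> as a sum of at most \<open>2\<^sup>k * 2\<^sup>k\<close> products. Fewer than \<open>k\<close>
  differing coordinates give a singular matrix and exactly \<open>k\<close> give a regular one; the weights
  \<open>c\<^sub>l > 0\<close> are chosen one after the other, each so small that the determinants that are already
  nonzero remain so.\<close>

section \<open>Rank estimates from above and below\<close>

text \<open>Each summand is an outer product, hence of rank at most 1, and rank is
  subadditive.\<close>

lemma (in vec_space) rank_sum_products_le:
  fixes f g :: "'t \<Rightarrow> nat \<Rightarrow> 'a"
  assumes "finite T"
  shows "rank (mat n nc (\<lambda>(i, j). \<Sum>t\<in>T. f t i * g t j)) \<le> card T"
  using assms
proof (induction T rule: finite_induct)
  case empty
  have "mat n nc (\<lambda>(i, j). \<Sum>t\<in>{}. f t i * g t j) = 0\<^sub>m n nc"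
    by (intro eq_matI) auto
  then show ?case
    by (simp only: rank_0I card.empty)
next
  case (insert t T)
  let ?A = "mat n nc (\<lambda>(i, j). f t i * g t j)"
  let ?B = "mat n nc (\<lambda>(i, j). \<Sum>t\<in>T. f t i * g t j)"
  have "mat n nc (\<lambda>(i, j). \<Sum>t\<in>insert t T. f t i * g t j) = ?A + ?B"
    using insert.hyps by (intro eq_matI) auto
  moreover have "rank (?A + ?B) \<le> rank ?A + rank ?B"
    by (intro rank_subadditive) auto
  moreover have "rank ?A \<le> 1"
    by (rule rank_le_1_product_entries[where f = "f t" and g = "g t"]) auto
  ultimately show ?case
    using insert by simp
qed

text \<open>In row \<open>r j\<close> only column \<open>j\<close> among the columns in
  \<open>C\<close> is nonzero, so this coordinate of a vanishing linear combination isolates the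
  coefficient of column \<open>j\<close>.\<close>

lemma (in vec_space) rank_ge_card_pivots:
  assumes A: "A \<in> carrier_mat n nc" and C: "C \<subseteq> {..<nc}"
    and r: "\<And>j. j \<in> C \<Longrightarrow> r j < n"
    and nz: "\<And>j. j \<in> C \<Longrightarrow> A $$ (r j, j) \<noteq> 0"
    and z: "\<And>j j'. j \<in> C \<Longrightarrow> j' \<in> C \<Longrightarrow> j' \<noteq> j \<Longrightarrow> A $$ (r j, j') = 0"
  shows "card C \<le> rank A"
proof -
  have fin: "finite C"
    using C finite_subset by blast
  have entry: "col A j' $ r j = A $$ (r j, j')" if "j \<in> C" "j' \<in> C" for j j'
    using that A C r by auto
  have inj: "inj_on (col A) C"
  proof (rule inj_onI)
    fix j j' assume "j \<in> C" "j' \<in> C" "col A j = col A j'"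
    then show "j = j'"
      using entry[of j j] entry[of j j'] nz z by metis
  qed
  have sub: "col A ` C \<subseteq> carrier_vec n"
    using A by auto
  have "lin_indpt (col A ` C)"
  proof (rule finite_lin_indpt2)
    show "finite (col A ` C)"
      using fin by simp
    show "col A ` C \<subseteq> carrier_vec n"
      by (fact sub)
    fix a assume lc: "lincomb a (col A ` C) = 0\<^sub>v n"
    show "\<forall>v\<in>col A ` C. a v = 0"
    proof
      fix v assume "v \<in> col A ` C"
      then obtain j where j: "j \<in> C" "v = col A j"
        by blast
      have "0 = lincomb a (col A ` C) $ r j"
        using lc r j by simp
      also have "\<dots> = (\<Sum>x\<in>col A ` C. a x * x $ r j)"
        by (rule lincomb_index) (use r j sub in auto)
      also have "\<dots> = (\<Sum>j'\<in>C. a (col A j') * A $$ (r j, j'))"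
        using j entry by (simp add: sum.reindex[OF inj])
      also have "\<dots> = a (col A j) * A $$ (r j, j)"
        using z j by (subst sum.remove[OF fin j(1)]) auto
      finally show "a v = 0"
        using nz j by simp
    qed
  qed
  moreover have "col A ` C \<subseteq> set (cols A)"
    using A C by (auto simp: cols_def)
  ultimately have "card (col A ` C) \<le> rank A"
    using A rank_ge_card_indpt by blast
  then show ?thesis
    using card_image[OF inj] by simp
qed

section \<open>Laplace expansion of the determinant of a sum\<close>

lemma sum_permutes_image_factor:
  fixes K I J :: "nat set"
  assumes K: "finite K" and I: "I \<subseteq> K"
  shows "\<exists>f g :: (nat \<Rightarrow> nat \<Rightarrow> 'a :: comm_ring_1) \<Rightarrow> 'a. \<forall>X Y.
    (\<Sum>\<pi> | \<pi> permutes K \<and> \<pi> ` I = J. signof \<pi> * ((\<Prod>i\<in>I. X i (\<pi> i)) * (\<Prod>i\<in>K - I. Y i (\<pi> i))))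
      = f X * g Y"
proof (cases "\<exists>\<rho>. \<rho> permutes K \<and> \<rho> ` I = J")
  case False
  then have none: "{\<pi>. \<pi> permutes K \<and> \<pi> ` I = J} = {}"
    by blast
  show ?thesis
    unfolding none by (intro exI[of _ "\<lambda>_. 0"]) simp
next
  case True
  then obtain \<rho> where \<rho>: "\<rho> permutes K" "\<rho> ` I = J"
    by blast
  define f where "f X = signof \<rho> * (\<Sum>\<sigma> | \<sigma> permutes I. signof \<sigma> * (\<Prod>i\<in>I. X i (\<rho> (\<sigma> i))))"
    for X :: "nat \<Rightarrow> nat \<Rightarrow> 'a"
  define g where "g Y = (\<Sum>\<tau> | \<tau> permutes K - I. signof \<tau> * (\<Prod>i\<in>K - I. Y i (\<rho> (\<tau> i))))"
    for Y :: "nat \<Rightarrow> nat \<Rightarrow> 'a"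
  let ?\<rho>' = "inv_into UNIV \<rho>"
  have inj\<rho>: "inj \<rho>"
    using \<rho>(1) by (rule permutes_inj)
  have fact: "(\<Sum>\<pi> | \<pi> permutes K \<and> \<pi> ` I = J.
      signof \<pi> * ((\<Prod>i\<in>I. X i (\<pi> i)) * (\<Prod>i\<in>K - I. Y i (\<pi> i)))) = f X * g Y" for X Y
  proof -
    let ?S = "{\<sigma>. \<sigma> permutes I}" and ?T = "{\<tau>. \<tau> permutes K - I}"
    let ?h = "\<lambda>(\<sigma>, \<tau>). (signof \<rho> * (signof \<sigma> * (\<Prod>i\<in>I. X i (\<rho> (\<sigma> i))))) *
      (signof \<tau> * (\<Prod>i\<in>K - I. Y i (\<rho> (\<tau> i))))"
    have "f X * g Y = (\<Sum>p\<in>?S \<times> ?T. ?h p)"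
      by (simp only: f_def g_def sum_distrib_left[of "signof \<rho>"] sum_product sum.cartesian_product)
    also have "\<dots> = (\<Sum>\<pi> | \<pi> permutes K \<and> \<pi> ` I = J.
      signof \<pi> * ((\<Prod>i\<in>I. X i (\<pi> i)) * (\<Prod>i\<in>K - I. Y i (\<pi> i))))"
    \<comment> \<open>The inverse map cancels \<open>\<rho>\<close> and cuts the rest into its
      actions on \<open>I\<close> and on \<open>K - I\<close>, each extended by the
      identity.\<close>
    proof (rule sum.reindex_bij_witness[where
        i = "\<lambda>\<pi>. (restrict_id (?\<rho>' \<circ> \<pi>) I, restrict_id (?\<rho>' \<circ> \<pi>) (K - I))" and
        j = "\<lambda>(\<sigma>, \<tau>). \<rho> \<circ> (\<sigma> \<circ> \<tau>)"])
      fix p assume "p \<in> ?S \<times> ?T"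
      then obtain \<sigma> \<tau> where p: "p = (\<sigma>, \<tau>)" and \<sigma>: "\<sigma> permutes I" and \<tau>: "\<tau> permutes K - I"
        by blast
      have on_I: "(\<sigma> \<circ> \<tau>) i = \<sigma> i" if "i \<in> I" for i
        using that permutes_not_in[OF \<tau>, of i] by simp
      have on_K: "(\<sigma> \<circ> \<tau>) i = \<tau> i" if "i \<in> K - I" for i
        using that permutes_in_image[OF \<tau>, of i] permutes_not_in[OF \<sigma>, of "\<tau> i"] by auto
      have \<sigma>K: "\<sigma> permutes K" and \<tau>K: "\<tau> permutes K"
        using \<sigma> \<tau> I by (auto intro: permutes_subset)
      have inv: "?\<rho>' \<circ> (\<rho> \<circ> (\<sigma> \<circ> \<tau>)) = \<sigma> \<circ> \<tau>"
        using permutes_inv_o(2)[OF \<rho>(1)] by (metis comp_assoc id_comp)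
      have "restrict_id (\<sigma> \<circ> \<tau>) I = \<sigma>"
        using on_I permutes_not_in[OF \<sigma>] by (auto simp: restrict_id_def fun_eq_iff)
      moreover have "restrict_id (\<sigma> \<circ> \<tau>) (K - I) = \<tau>"
        using on_K permutes_not_in[OF \<tau>] by (auto simp: restrict_id_def fun_eq_iff)
      ultimately show "(restrict_id (?\<rho>' \<circ> (case p of (\<sigma>, \<tau>) \<Rightarrow> \<rho> \<circ> (\<sigma> \<circ> \<tau>))) I,
          restrict_id (?\<rho>' \<circ> (case p of (\<sigma>, \<tau>) \<Rightarrow> \<rho> \<circ> (\<sigma> \<circ> \<tau>))) (K - I)) = p"
        using p inv by simp
      have "(\<rho> \<circ> (\<sigma> \<circ> \<tau>)) ` I = \<rho> ` (\<sigma> ` I)"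
        using on_I by (simp add: image_image)
      also have "\<dots> = J"
        using permutes_image[OF \<sigma>] \<rho>(2) by simp
      finally show "(case p of (\<sigma>, \<tau>) \<Rightarrow> \<rho> \<circ> (\<sigma> \<circ> \<tau>)) \<in> {\<pi>. \<pi> permutes K \<and> \<pi> ` I = J}"
        using p \<rho>(1) \<sigma>K \<tau>K by (simp add: permutes_compose)
      have perm: "permutation \<rho>" "permutation \<sigma>" "permutation \<tau>"
        using \<rho>(1) \<sigma>K \<tau>K K permutation_permutes by blast+
      have sign: "sign (\<rho> \<circ> (\<sigma> \<circ> \<tau>)) = sign \<rho> * (sign \<sigma> * sign \<tau>)"
        using perm by (simp add: sign_compose permutation_compose)
      have "(\<Prod>i\<in>I. X i ((\<rho> \<circ> (\<sigma> \<circ> \<tau>)) i)) = (\<Prod>i\<in>I. X i (\<rho> (\<sigma> i)))"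
        using on_I by simp
      moreover have "(\<Prod>i\<in>K - I. Y i ((\<rho> \<circ> (\<sigma> \<circ> \<tau>)) i)) = (\<Prod>i\<in>K - I. Y i (\<rho> (\<tau> i)))"
        using on_K by (intro prod.cong) auto
      ultimately show "signof (case p of (\<sigma>, \<tau>) \<Rightarrow> \<rho> \<circ> (\<sigma> \<circ> \<tau>)) *
          ((\<Prod>i\<in>I. X i ((case p of (\<sigma>, \<tau>) \<Rightarrow> \<rho> \<circ> (\<sigma> \<circ> \<tau>)) i)) *
           (\<Prod>i\<in>K - I. Y i ((case p of (\<sigma>, \<tau>) \<Rightarrow> \<rho> \<circ> (\<sigma> \<circ> \<tau>)) i))) = ?h p"
        unfolding p prod.case sign by (simp only: of_int_mult mult_ac)
    next
      fix \<pi> assume "\<pi> \<in> {\<pi>. \<pi> permutes K \<and> \<pi> ` I = J}"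
      then have \<pi>: "\<pi> permutes K" "\<pi> ` I = J"
        by auto
      \<comment> \<open>Both \<open>\<pi>\<close> and \<open>\<rho>\<close> send \<open>I\<close>
        onto \<open>J\<close>, so \<open>\<phi>\<close> preserves \<open>I\<close> and therefore
        also \<open>K - I\<close>.\<close>
      define \<phi> where "\<phi> = ?\<rho>' \<circ> \<pi>"
      have \<phi>: "\<phi> permutes K"
        unfolding \<phi>_def using \<pi>(1) \<rho>(1) by (simp add: permutes_compose permutes_inv)
      have \<phi>I: "\<phi> ` I = I"
        unfolding \<phi>_def image_comp[symmetric] \<pi>(2) \<rho>(2)[symmetric]
        using inj\<rho> by (simp add: image_comp)
      have \<phi>K: "\<phi> ` (K - I) = K - I"
        using permutes_image[OF \<phi>] \<phi>I image_set_diff[OF permutes_inj[OF \<phi>]] by simp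
      have r1: "restrict_id \<phi> I permutes I" and r2: "restrict_id \<phi> (K - I) permutes K - I"
        using \<phi>I \<phi>K permutes_inj_on[OF \<phi>]
        by (auto intro!: permutes_restrict_id simp: bij_betw_def)
      then show "(restrict_id (?\<rho>' \<circ> \<pi>) I, restrict_id (?\<rho>' \<circ> \<pi>) (K - I)) \<in> ?S \<times> ?T"
        unfolding \<phi>_def by simp
      have "restrict_id \<phi> I \<circ> restrict_id \<phi> (K - I) = \<phi>"
        using \<phi>K permutes_not_in[OF \<phi>] I by (fastforce simp: restrict_id_def fun_eq_iff)
      then show "(case (restrict_id (?\<rho>' \<circ> \<pi>) I, restrict_id (?\<rho>' \<circ> \<pi>) (K - I)) of
          (\<sigma>, \<tau>) \<Rightarrow> \<rho> \<circ> (\<sigma> \<circ> \<tau>)) = \<pi>"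
        using permutes_inv_o(1)[OF \<rho>(1)] unfolding \<phi>_def prod.case by (metis comp_assoc id_comp)
    qed
    finally show ?thesis ..
  qed
  then show ?thesis
    by blast
qed

lemma det_add_sum_products:
  "\<exists>f g :: nat set \<times> nat set \<Rightarrow> 'a :: comm_ring_1 mat \<Rightarrow> 'a.
    \<forall>X \<in> carrier_mat k k. \<forall>Y \<in> carrier_mat k k.
      det (X + Y) = (\<Sum>t\<in>Pow {0..<k} \<times> Pow {0..<k}. f t X * g t Y)"
proof -
  let ?K = "{0..<k}"
  let ?P = "\<lambda>I J. {\<pi>. \<pi> permutes ?K \<and> \<pi> ` I = J}"
  have "\<forall>t \<in> Pow ?K \<times> Pow ?K. \<exists>fg :: ((nat \<Rightarrow> nat \<Rightarrow> 'a) \<Rightarrow> 'a) \<times> ((nat \<Rightarrow> nat \<Rightarrow> 'a) \<Rightarrow> 'a).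
    \<forall>X Y. (\<Sum>\<pi>\<in>?P (fst t) (snd t). signof \<pi> *
      ((\<Prod>i\<in>fst t. X i (\<pi> i)) * (\<Prod>i\<in>?K - fst t. Y i (\<pi> i)))) = fst fg X * snd fg Y"
    using sum_permutes_image_factor[of ?K] by auto
  from bchoice[OF this] obtain fg ::
    "nat set \<times> nat set \<Rightarrow> ((nat \<Rightarrow> nat \<Rightarrow> 'a) \<Rightarrow> 'a) \<times> ((nat \<Rightarrow> nat \<Rightarrow> 'a) \<Rightarrow> 'a)" where
    all: "\<forall>t \<in> Pow ?K \<times> Pow ?K. \<forall>X Y. (\<Sum>\<pi>\<in>?P (fst t) (snd t). signof \<pi> *
      ((\<Prod>i\<in>fst t. X i (\<pi> i)) * (\<Prod>i\<in>?K - fst t. Y i (\<pi> i)))) = fst (fg t) X * snd (fg t) Y"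
    ..
  have fg: "(\<Sum>\<pi>\<in>?P I J. signof \<pi> *
      ((\<Prod>i\<in>I. X i (\<pi> i)) * (\<Prod>i\<in>?K - I. Y i (\<pi> i)))) = fst (fg (I, J)) X * snd (fg (I, J)) Y"
    if "I \<subseteq> ?K" "J \<subseteq> ?K" for I J X Y
    using that bspec[OF all, of "(I, J)"] by simp
  define f where "f t = fst (fg t)" for t
  define g where "g t = snd (fg t)" for t
  have "det (X + Y) = (\<Sum>t\<in>Pow ?K \<times> Pow ?K.
      f t (\<lambda>i j. X $$ (i, j)) * g t (\<lambda>i j. Y $$ (i, j)))"
    if X: "X \<in> carrier_mat k k" and Y: "Y \<in> carrier_mat k k" for X Y
  proof -
    let ?t = "\<lambda>\<pi> I. signof \<pi> * ((\<Prod>i\<in>I. X $$ (i, \<pi> i)) * (\<Prod>i\<in>?K - I. Y $$ (i, \<pi> i)))"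
    have fin: "finite {\<pi>. \<pi> permutes ?K}"
      by (simp add: finite_permutations)
    have "det (X + Y) = (\<Sum>\<pi> | \<pi> permutes ?K. signof \<pi> * (\<Prod>i\<in>?K. X $$ (i, \<pi> i) + Y $$ (i, \<pi> i)))"
      using X Y by (subst det_def'[of _ k]) (auto intro!: sum.cong prod.cong simp: permutes_in_image)
    also have "\<dots> = (\<Sum>\<pi> | \<pi> permutes ?K. \<Sum>I\<in>Pow ?K. ?t \<pi> I)"
      by (simp add: prod_add sum_distrib_left)
    also have "\<dots> = (\<Sum>I\<in>Pow ?K. \<Sum>\<pi> | \<pi> permutes ?K. ?t \<pi> I)"
      by (rule sum.swap)
    also have "\<dots> = (\<Sum>I\<in>Pow ?K. \<Sum>J\<in>Pow ?K. \<Sum>\<pi>\<in>?P I J. ?t \<pi> I)"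
    proof (rule sum.cong[OF refl])
      fix I assume "I \<in> Pow ?K"
      then have "(\<lambda>\<pi>. \<pi> ` I) ` {\<pi>. \<pi> permutes ?K} \<subseteq> Pow ?K"
        using permutes_image by fastforce
      from sum.group[OF fin _ this, of "\<lambda>\<pi>. ?t \<pi> I"]
      show "(\<Sum>\<pi> | \<pi> permutes ?K. ?t \<pi> I) = (\<Sum>J\<in>Pow ?K. \<Sum>\<pi>\<in>?P I J. ?t \<pi> I)"
        by simp
    qed
    also have "\<dots> = (\<Sum>I\<in>Pow ?K. \<Sum>J\<in>Pow ?K.
        f (I, J) (\<lambda>i j. X $$ (i, j)) * g (I, J) (\<lambda>i j. Y $$ (i, j)))"
      unfolding f_def g_def using fg by (intro sum.cong refl) auto
    finally show ?thesis
      by (simp add: sum.cartesian_product)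
  qed
  then show ?thesis
    by (intro exI[of _ "\<lambda>t X. f t (\<lambda>i j. X $$ (i, j))"] exI[of _ "\<lambda>t Y. g t (\<lambda>i j. Y $$ (i, j))"] ballI)
qed

section \<open>Vectors as coefficient lists of polynomials\<close>

text \<open>Vectors of length \<open>k\<close> are read as polynomials of degree below
  \<open>k\<close>; this turns kernel vectors of the Hankel matrices below into polynomials with
  prescribed roots.\<close>

definition vec_eval :: "'a :: comm_semiring_1 vec \<Rightarrow> 'a \<Rightarrow> 'a" where
  "vec_eval v x = (\<Sum>i<dim_vec v. v $ i * x ^ i)"

lemma card_vec_eval_roots:
  fixes v :: "'a :: idom vec"
  assumes v: "v \<in> carrier_vec k" "v \<noteq> 0\<^sub>v k" and S: "\<And>x. x \<in> S \<Longrightarrow> vec_eval v x = 0"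
  shows "card S < k"
proof -
  define p where "p = (\<Sum>i<k. monom (v $ i) i)"
  have coeff: "coeff p j = (if j < k then v $ j else 0)" for j
    unfolding p_def by (simp add: coeff_sum)
  obtain i where i: "i < k" "v $ i \<noteq> 0"
    using v by (metis carrier_vecD eq_vecI index_zero_vec)
  then have p: "p \<noteq> 0"
    using coeff[of i] by auto
  have "degree p < k"
    using i by (intro degree_lessI) (auto simp: coeff)
  moreover have "poly p x = vec_eval v x" for x
    using v unfolding p_def vec_eval_def by (simp add: poly_sum poly_monom)
  then have "S \<subseteq> {x. poly p x = 0}"
    using S by auto
  then have "card S \<le> card {x. poly p x = 0}"
    using poly_roots_finite[OF p] by (intro card_mono)
  ultimately show ?thesis
    using card_poly_roots_bound[OF p] by linarith
qed

text \<open>The product of linear factors has degree \<open>card S < k\<close>, so its coefficients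
  fit into a vector of length \<open>k\<close>.\<close>

lemma ex_vec_eval_eq_prod:
  fixes S :: "'a :: idom set"
  assumes "finite S" "card S < k"
  shows "\<exists>v \<in> carrier_vec k. \<forall>x. vec_eval v x = (\<Prod>a\<in>S. x - a)"
proof -
  define p where "p = (\<Prod>a\<in>S. [:- a, 1:])"
  have deg: "degree p = card S"
    unfolding p_def by (subst degree_prod_eq_sum_degree) auto
  have "vec_eval (vec k (coeff p)) x = (\<Prod>a\<in>S. x - a)" for x
  proof -
    have "vec_eval (vec k (coeff p)) x = (\<Sum>i<k. coeff p i * x ^ i)"
      unfolding vec_eval_def by simp
    also have "\<dots> = (\<Sum>i\<le>degree p. coeff p i * x ^ i)"
      using assms deg by (intro sum.mono_neutral_right) (auto simp: coeff_eq_0)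
    also have "\<dots> = poly p x"
      by (simp add: poly_altdef)
    finally show ?thesis
      unfolding p_def by (simp add: poly_prod)
  qed
  then show ?thesis
    by (intro bexI[of _ "vec k (coeff p)"]) auto
qed

section \<open>Singular and regular Hankel matrices\<close>

text \<open>This is \<open>V\<^sup>T D V\<close> with the Vandermonde matrix \<open>V\<close> on the
  nodes \<open>0, \<dots>, n - 1\<close> and the diagonal matrix \<open>D\<close> of the weights
  \<open>s\<close>.\<close>

definition hankel :: "nat \<Rightarrow> nat \<Rightarrow> (nat \<Rightarrow> real) \<Rightarrow> real mat" where
  "hankel k n s = mat k k (\<lambda>(i, j). \<Sum>l<n. s l * real l ^ (i + j))"

lemma hankel_carrier [simp]: "hankel k n s \<in> carrier_mat k k"
  unfolding hankel_def by simp

lemma hankel_add: "hankel k n s + hankel k n t = hankel k n (\<lambda>l. s l + t l)"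
  unfolding hankel_def by (intro eq_matI) (auto simp: algebra_simps sum.distrib)

lemma hankel_mult_vec_index:
  assumes "v \<in> carrier_vec k" "i < k"
  shows "(hankel k n s *\<^sub>v v) $ i = (\<Sum>l<n. s l * vec_eval v (real l) * real l ^ i)"
proof -
  have "(hankel k n s *\<^sub>v v) $ i = (\<Sum>j<k. (\<Sum>l<n. s l * real l ^ (i + j)) * v $ j)"
    using assms unfolding hankel_def by (auto simp: scalar_prod_def atLeast0LessThan intro!: sum.cong)
  also have "\<dots> = (\<Sum>j<k. \<Sum>l<n. s l * (v $ j * real l ^ j) * real l ^ i)"
    by (simp add: sum_distrib_right sum_distrib_left power_add mult_ac)
  also have "\<dots> = (\<Sum>l<n. \<Sum>j<k. s l * (v $ j * real l ^ j) * real l ^ i)"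
    by (rule sum.swap)
  also have "\<dots> = (\<Sum>l<n. s l * vec_eval v (real l) * real l ^ i)"
    using assms unfolding vec_eval_def by (simp add: sum_distrib_left sum_distrib_right)
  finally show ?thesis .
qed

text \<open>On polynomials the matrix acts as the form that sends \<open>p\<close> and
  \<open>q\<close> to the sum of \<open>s l * p(l) * q(l)\<close> over the nodes.\<close>

lemma hankel_bilinear:
  assumes "v \<in> carrier_vec k" "w \<in> carrier_vec k"
  shows "w \<bullet> (hankel k n s *\<^sub>v v) = (\<Sum>l<n. s l * vec_eval v (real l) * vec_eval w (real l))"
proof -
  have "w \<bullet> (hankel k n s *\<^sub>v v) = (\<Sum>i<k. w $ i * (\<Sum>l<n. s l * vec_eval v (real l) * real l ^ i))"
    unfolding scalar_prod_def using hankel_mult_vec_index[OF assms(1)]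
    by (simp add: hankel_def atLeast0LessThan)
  also have "\<dots> = (\<Sum>i<k. \<Sum>l<n. s l * vec_eval v (real l) * (w $ i * real l ^ i))"
    by (simp add: sum_distrib_left mult_ac)
  also have "\<dots> = (\<Sum>l<n. \<Sum>i<k. s l * vec_eval v (real l) * (w $ i * real l ^ i))"
    by (rule sum.swap)
  also have "\<dots> = (\<Sum>l<n. s l * vec_eval v (real l) * vec_eval w (real l))"
    using assms unfolding vec_eval_def by (simp add: sum_distrib_left)
  finally show ?thesis .
qed

text \<open>The polynomial whose roots are the fewer than \<open>k\<close> nodes of nonzero weight
  has degree below \<open>k\<close>, and its coefficient vector lies in the kernel.\<close>

lemma det_hankel_eq_0:
  assumes "card {l. l < n \<and> s l \<noteq> 0} < k"
  shows "det (hankel k n s) = 0"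
proof -
  let ?S = "real ` {l. l < n \<and> s l \<noteq> 0}"
  have "finite ?S" "card ?S < k"
    using assms by (auto simp: card_image)
  then obtain v where v: "v \<in> carrier_vec k" and ev: "\<And>x. vec_eval v x = (\<Prod>a\<in>?S. x - a)"
    using ex_vec_eval_eq_prod by blast
  \<comment> \<open>The kernel vector is nonzero because its polynomial does not vanish at a point
    outside the finite root set.\<close>
  have "infinite (UNIV - ?S)"
    using \<open>finite ?S\<close> infinite_UNIV_char_0 by (metis Diff_infinite_finite)
  then obtain x where "x \<notin> ?S"
    by (metis Diff_iff finite.emptyI ex_in_conv)
  then have "vec_eval v x \<noteq> 0"
    using ev \<open>finite ?S\<close> by auto
  then have "v \<noteq> 0\<^sub>v k"
    by (auto simp: vec_eval_def)
  moreover have "s l * vec_eval v (real l) = 0" if "l < n" for l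
    using that ev \<open>finite ?S\<close> by auto
  then have "(hankel k n s *\<^sub>v v) $ i = 0" if "i < k" for i
    unfolding hankel_mult_vec_index[OF v that] by (intro sum.neutral) auto
  then have "hankel k n s *\<^sub>v v = 0\<^sub>v k"
    by (intro eq_vecI) (simp_all add: hankel_def)
  ultimately show ?thesis
    using v det_0_iff_vec_prod_zero[OF hankel_carrier] by blast
qed

lemma det_hankel_neq_0:
  assumes card: "card {l. l < n \<and> s l \<noteq> 0} = k"
  shows "det (hankel k n s) \<noteq> 0"
proof
  let ?D = "{l. l < n \<and> s l \<noteq> 0}"
  assume "det (hankel k n s) = 0"
  then obtain v where v: "v \<in> carrier_vec k" "v \<noteq> 0\<^sub>v k" and ker: "hankel k n s *\<^sub>v v = 0\<^sub>v k"
    using det_0_iff_vec_prod_zero[OF hankel_carrier] by blast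
  have "vec_eval v (real m) = 0" if m: "m \<in> ?D" for m
  proof -
    \<comment> \<open>The test polynomial \<open>w\<close> vanishes at the other
      \<open>k - 1\<close> nodes of nonzero weight, so only the term of \<open>m\<close> survives in
      the bilinear form.\<close>
    let ?S = "real ` (?D - {m})"
    have "card (?D - {m}) < card ?D"
      using m by (intro psubset_card_mono) auto
    then have "card ?S < k"
      using card by (simp add: card_image)
    then obtain w where w: "w \<in> carrier_vec k" and ev: "\<And>x. vec_eval w x = (\<Prod>a\<in>?S. x - a)"
      using ex_vec_eval_eq_prod[of ?S k] by auto
    have "0 = (\<Sum>l<n. s l * vec_eval v (real l) * vec_eval w (real l))"
      using hankel_bilinear[OF v(1) w, of n s] ker w by simp
    also have "\<dots> = (\<Sum>l\<in>{m}. s l * vec_eval v (real l) * vec_eval w (real l))"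
      using m by (intro sum.mono_neutral_right) (auto simp: ev)
    finally have "s m * vec_eval v (real m) * vec_eval w (real m) = 0"
      by simp
    moreover have "vec_eval w (real m) \<noteq> 0"
      by (auto simp: ev)
    ultimately show ?thesis
      using m by simp
  qed
  then have "card (real ` ?D) < k"
    using v by (intro card_vec_eval_roots) auto
  then show False
    using card by (simp add: card_image)
qed

section \<open>Choice of the weights\<close>

lemma isCont_det_hankel:
  assumes "\<And>l. l < n \<Longrightarrow> isCont (\<lambda>e. s e l) a"
  shows "isCont (\<lambda>e. det (hankel k n (s e))) a"
proof -
  have "det (hankel k n (s e)) = (\<Sum>\<pi> | \<pi> permutes {0..<k}.
      signof \<pi> * (\<Prod>i = 0..<k. \<Sum>l<n. s e l * real l ^ (i + \<pi> i)))" for e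
    unfolding det_def'[OF hankel_carrier]
    by (auto simp: hankel_def permutes_in_image intro!: sum.cong prod.cong)
  moreover have "isCont (\<lambda>e. \<Sum>\<pi> | \<pi> permutes {0..<k}.
      signof \<pi> * (\<Prod>i = 0..<k. \<Sum>l<n. s e l * real l ^ (i + \<pi> i))) a"
    by (intro continuous_intros assms) auto
  ultimately show ?thesis
    by simp
qed

lemma hankel_cong: "(\<And>l. l < n \<Longrightarrow> s l = t l) \<Longrightarrow> hankel k n s = hankel k n t"
  unfolding hankel_def by (intro eq_matI) auto

text \<open>Induction on the number of nodes, adding a small weight \<open>e\<close> at node
  \<open>n\<close>. Patterns \<open>d\<close> with at least \<open>k\<close> nonzero values before
  \<open>n\<close> are regular at \<open>e = 0\<close> and stay so for small \<open>e\<close> by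
  continuity. Any other admissible pattern has exactly \<open>k\<close> nonzero values, where every
  positive weight works.\<close>

lemma ex_weights_det_hankel_neq_0:
  "\<exists>c. (\<forall>l. c l > 0) \<and> (\<forall>d. (\<forall>l<n. d l \<in> {-1, 0, 1}) \<longrightarrow> k \<le> card {l. l < n \<and> d l \<noteq> 0} \<longrightarrow>
    det (hankel k n (\<lambda>l. c l * d l)) \<noteq> 0)"
proof (induction n)
  case 0
  show ?case
    \<comment> \<open>Without nodes the condition on \<open>d\<close> forces
      \<open>k = 0\<close>.\<close>
    using det_hankel_neq_0[of 0 _ k] by (intro exI[of _ "\<lambda>_. 1"]) auto
next
  case (Suc n)
  then obtain c where pos: "\<And>l. c l > 0" and c: "\<And>d. \<forall>l<n. d l \<in> {-1, 0, 1} \<Longrightarrow>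
      k \<le> card {l. l < n \<and> d l \<noteq> 0} \<Longrightarrow> det (hankel k n (\<lambda>l. c l * d l)) \<noteq> 0"
    by (elim exE conjE) blast
  define F where "F d e = det (hankel k (Suc n) (\<lambda>l. (c(n := e)) l * d l))" for d e
  \<comment> \<open>Extensional functions make the set of patterns finite, so a single
    \<open>e\<close> can serve all of them.\<close>
  let ?D = "{d \<in> {..n} \<rightarrow>\<^sub>E {-1, 0, 1}. k \<le> card {l. l < n \<and> d l \<noteq> 0}}"
  have fin: "finite ?D"
    by (intro finite_subset[of ?D "{..n} \<rightarrow>\<^sub>E {-1, 0, 1}"] finite_PiE) auto
  have "eventually (\<lambda>e. F d e \<noteq> 0) (at_right 0)" if d: "d \<in> ?D" for d
  proof -
    \<comment> \<open>Weight 0 removes node \<open>n\<close>, which leaves the determinant of the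
      induction hypothesis.\<close>
    have "F d 0 = det (hankel k n (\<lambda>l. c l * d l))"
      unfolding F_def hankel_def by simp
    moreover have "\<dots> \<noteq> 0"
      using d by (intro c) (auto simp: PiE_iff)
    moreover have "isCont (F d) 0"
      unfolding F_def
    proof (rule isCont_det_hankel)
      fix l assume "l < Suc n"
      show "isCont (\<lambda>e. (c(n := e)) l * d l) 0"
        by (cases "l = n") auto
    qed
    then have "(F d \<longlongrightarrow> F d 0) (at_right 0)"
      unfolding isCont_def by (rule filterlim_at_split[THEN iffD1, THEN conjunct2])
    ultimately show ?thesis
      using tendsto_imp_eventually_ne by metis
  qed
  then have "eventually (\<lambda>e. \<forall>d\<in>?D. F d e \<noteq> 0) (at_right 0)"
    by (intro eventually_ball_finite fin) auto
  moreover have "eventually (\<lambda>e::real. e > 0) (at_right 0)"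
    by (rule eventually_at_right_less)
  ultimately have "eventually (\<lambda>e. (\<forall>d\<in>?D. F d e \<noteq> 0) \<and> e > 0) (at_right 0)"
    by (rule eventually_conj)
  then obtain e where e: "\<And>d. d \<in> ?D \<Longrightarrow> F d e \<noteq> 0" and "e > 0"
    using eventually_happens'[OF trivial_limit_at_right_real] by blast
  have pos': "(c(n := e)) l > 0" for l
    using pos \<open>e > 0\<close> by simp
  have "det (hankel k (Suc n) (\<lambda>l. (c(n := e)) l * d l)) \<noteq> 0"
    if d: "\<forall>l<Suc n. d l \<in> {-1, 0, 1}" and k: "k \<le> card {l. l < Suc n \<and> d l \<noteq> 0}" for d
  proof (cases "k \<le> card {l. l < n \<and> d l \<noteq> 0}")
    case True
    \<comment> \<open>Values of \<open>d\<close> beyond \<open>n\<close> do not enter the matrix;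
      cutting them off yields a member of \<open>?D\<close>.\<close>
    let ?d = "restrict d {..n}"
    have "{l. l < n \<and> ?d l \<noteq> 0} = {l. l < n \<and> d l \<noteq> 0}"
      by auto
    then have "?d \<in> ?D"
      using d True by (auto simp: less_Suc_eq_le)
    then have "F ?d e \<noteq> 0"
      by (rule e)
    moreover have "hankel k (Suc n) (\<lambda>l. (c(n := e)) l * ?d l)
        = hankel k (Suc n) (\<lambda>l. (c(n := e)) l * d l)"
      by (rule hankel_cong) (simp add: less_Suc_eq_le)
    ultimately show ?thesis
      unfolding F_def by simp
  next
    case False
    have "{l. l < Suc n \<and> d l \<noteq> 0} \<subseteq> insert n {l. l < n \<and> d l \<noteq> 0}"
      by (auto simp: less_Suc_eq)
    then have "card {l. l < Suc n \<and> d l \<noteq> 0} \<le> card (insert n {l. l < n \<and> d l \<noteq> 0})"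
      by (intro card_mono) auto
    then have "card {l. l < Suc n \<and> d l \<noteq> 0} = k"
      using False k by simp
    moreover have "{l. l < Suc n \<and> (c(n := e)) l * d l \<noteq> 0} = {l. l < Suc n \<and> d l \<noteq> 0}"
      using pos' by (metis (no_types, lifting) less_irrefl mult_eq_0_iff)
    ultimately show ?thesis
      by (intro det_hankel_neq_0) simp
  qed
  with pos' show ?case
    by blast
qed

section \<open>Hamming distance through bits, and the lower bound\<close>

lemma hamming_dist_cube_point:
  "hamming_dist (cube_point n i) (cube_point n j) = card {l. l < n \<and> bit i l \<noteq> bit j l}"
  unfolding hamming_dist_def cube_point_def by (rule arg_cong[where f = card]) auto

lemma same_support_HD_ge_iff:
  "same_support (HD_ge k n) A \<longleftrightarrow> A \<in> carrier_mat (2 ^ n) (2 ^ n) \<and>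
    (\<forall>i < 2 ^ n. \<forall>j < 2 ^ n. A $$ (i, j) = 0 \<longleftrightarrow> card {l. l < n \<and> bit i l \<noteq> bit j l} < k)"
  unfolding same_support_def HD_ge_def by (auto simp: hamming_dist_cube_point not_le)

lemma rank_same_support_HD_ge:
  assumes "k \<le> n" and A: "same_support (HD_ge k n) A"
  shows "2 ^ k \<le> vec_space.rank (2 ^ n) A"
proof -
  \<comment> \<open>The exclusive or with \<open>mask k\<close> flips the lowest \<open>k\<close>
    bits: the antipodal map on numbers below \<open>2 ^ k\<close>.\<close>
  let ?anti = "\<lambda>j :: nat. xor (mask k) j"
  have le: "(2 :: nat) ^ k \<le> 2 ^ n"
    using \<open>k \<le> n\<close> by simp
  have high: "\<not> bit i l" if "i < 2 ^ k" "k \<le> l" for i l :: nat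
    using that by (metis bit_take_bit_iff not_le take_bit_nat_eq_self)
  have anti: "?anti j < 2 ^ k" if "j < 2 ^ k" for j
  proof -
    have "take_bit k (?anti j) = ?anti j"
      using that high by (intro bit_eqI) (auto simp: bit_take_bit_iff bit_xor_iff bit_mask_iff not_le)
    then show ?thesis
      by (metis take_bit_nat_less_exp)
  qed
  \<comment> \<open>Differing from the antipode of \<open>j\<close> means agreeing with
    \<open>j\<close>, so the distance is the number of agreements among the first \<open>k\<close>
    bits. It reaches \<open>k\<close> only for \<open>i = j\<close>.\<close>
  have diff: "{l. l < n \<and> bit (?anti j) l \<noteq> bit i l} = {l. l < k \<and> bit i l = bit j l}"
    if "i < 2 ^ k" "j < 2 ^ k" for i j :: nat
    using that high \<open>k \<le> n\<close> by (force simp: bit_xor_iff bit_mask_iff)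
  have entry: "A $$ (?anti j, i) = 0 \<longleftrightarrow> card {l. l < k \<and> bit i l = bit j l} < k"
    if "i < 2 ^ k" "j < 2 ^ k" for i j
  proof -
    have "?anti j < 2 ^ n" "i < 2 ^ n"
      using less_le_trans[OF _ le] anti that by blast+
    then show ?thesis
      using A unfolding same_support_HD_ge_iff diff[OF that, symmetric] by blast
  qed
  have "card {..<(2 :: nat) ^ k} \<le> vec_space.rank (2 ^ n) A"
  proof (rule vec_space.rank_ge_card_pivots[where nc = "2 ^ n" and r = ?anti])
    show "A \<in> carrier_mat (2 ^ n) (2 ^ n)"
      using A by (simp add: same_support_HD_ge_iff)
    show "{..<(2 :: nat) ^ k} \<subseteq> {..<2 ^ n}"
      using le by auto
  next
    fix j :: nat assume j: "j \<in> {..<2 ^ k}"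
    then show "?anti j < 2 ^ n"
      using less_le_trans[OF anti le] by simp
    show "A $$ (?anti j, j) \<noteq> 0"
      using entry[of j j] j by simp
    fix i :: nat assume i: "i \<in> {..<2 ^ k}" "i \<noteq> j"
    then obtain l where l: "bit i l \<noteq> bit j l"
      using bit_eq_iff by blast
    then have "l < k"
      using high i j by (metis lessThan_iff not_le)
    then have "{l. l < k \<and> bit i l = bit j l} \<subset> {..<k}"
      using l by auto
    from psubset_card_mono[OF finite_lessThan this]
    have "card {l. l < k \<and> bit i l = bit j l} < k"
      by simp
    then show "A $$ (?anti j, i) = 0"
      using entry[of i j] i j by simp
  qed
  then show ?thesis
    by simp
qed

section \<open>A matrix of small rank with the required support\<close>

lemma ex_same_support_HD_ge_rank_le:
  "\<exists>A. same_support (HD_ge k n) A \<and> vec_space.rank (2 ^ n) A \<le> 4 ^ k"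
proof -
  obtain c where pos: "\<And>l. c l > 0" and c: "\<And>d. \<forall>l<n. d l \<in> {-1, 0, 1} \<Longrightarrow>
      k \<le> card {l. l < n \<and> d l \<noteq> 0} \<Longrightarrow> det (hankel k n (\<lambda>l. c l * d l)) \<noteq> 0"
    using ex_weights_det_hankel_neq_0[of n k] by (elim exE conjE) blast
  \<comment> \<open>The matrix is split into a part depending on the row index only and a part
    depending on the column index only; the minus sign goes into \<open>Y\<close>.\<close>
  define X where "X i = hankel k n (\<lambda>l. c l * of_bool (bit i l))" for i :: nat
  define Y where "Y j = hankel k n (\<lambda>l. - c l * of_bool (bit j l))" for j :: nat
  define d where "d i j l = (of_bool (bit i l) - of_bool (bit j l) :: real)" for i j l :: nat
  define A where "A = mat (2 ^ n) (2 ^ n) (\<lambda>(i, j). det (X i + Y j))"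
  have XY: "X i + Y j = hankel k n (\<lambda>l. c l * d i j l)" for i j
    unfolding X_def Y_def hankel_add d_def by (rule hankel_cong) (simp add: algebra_simps)
  have d0: "d i j l \<noteq> 0 \<longleftrightarrow> bit i l \<noteq> bit j l" for i j l
    by (auto simp: d_def)
  have c0: "c l \<noteq> 0" for l
    using pos[of l] by simp
  \<comment> \<open>As the weights are nonzero, the nodes of nonzero weight in
    \<open>X i + Y j\<close> are the differing coordinates. Fewer than \<open>k\<close> of them give
    a singular matrix, and the choice of \<open>c\<close> covers all other cases.\<close>
  have "det (X i + Y j) = 0 \<longleftrightarrow> card {l. l < n \<and> bit i l \<noteq> bit j l} < k" for i j
  proof
    assume "card {l. l < n \<and> bit i l \<noteq> bit j l} < k"
    then show "det (X i + Y j) = 0"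
      unfolding XY by (intro det_hankel_eq_0) (simp add: c0 d0)
  next
    assume "det (X i + Y j) = 0"
    then show "card {l. l < n \<and> bit i l \<noteq> bit j l} < k"
      using c[of "d i j"] unfolding XY d0 by (force simp: d_def)
  qed
  then have "same_support (HD_ge k n) A"
    unfolding same_support_HD_ge_iff A_def by simp
  moreover
  let ?T = "Pow {0..<k} \<times> Pow {0..<k}"
  obtain f g :: "nat set \<times> nat set \<Rightarrow> real mat \<Rightarrow> real" where
    fg: "\<And>X Y. X \<in> carrier_mat k k \<Longrightarrow> Y \<in> carrier_mat k k \<Longrightarrow>
      det (X + Y) = (\<Sum>t\<in>?T. f t X * g t Y)"
    using det_add_sum_products[of k, where 'a = real] by (elim exE) blast
  \<comment> \<open>Each pair of index sets contributes a function of \<open>i\<close> times a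
    function of \<open>j\<close>, hence rank at most 1, and there are \<open>2 ^ k * 2 ^ k\<close>
    pairs.\<close>
  have "A = mat (2 ^ n) (2 ^ n) (\<lambda>(i, j). \<Sum>t\<in>?T. f t (X i) * g t (Y j))"
    unfolding A_def by (intro eq_matI) (auto simp: X_def Y_def fg)
  then have "vec_space.rank (2 ^ n) A \<le> card ?T"
    using vec_space.rank_sum_products_le[of ?T "2 ^ n" "2 ^ n" "\<lambda>t i. f t (X i)" "\<lambda>t j. g t (Y j)"]
    by simp
  moreover have "card ?T = 4 ^ k"
    by (simp add: card_cartesian_product card_Pow flip: power_mult_distrib)
  ultimately show ?thesis
    by auto
qed

theorem theorem3p1:
  fixes k n :: nat
  assumes "k \<le> n"
  shows "2 ^ k \<le> suprank (HD_ge k n) \<and> suprank (HD_ge k n) \<le> 4 ^ k"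
proof
  have dim: "dim_row (HD_ge k n) = 2 ^ n"
    by (simp add: HD_ge_def)
  show "2 ^ k \<le> suprank (HD_ge k n)"
    using suprank_attained[of "HD_ge k n"] rank_same_support_HD_ge[OF assms] unfolding dim by metis
  obtain A where A: "same_support (HD_ge k n) A" "vec_space.rank (2 ^ n) A \<le> 4 ^ k"
    using ex_same_support_HD_ge_rank_le by blast
  then have "suprank (HD_ge k n) \<le> vec_space.rank (2 ^ n) A"
    unfolding suprank_def dim by (intro Least_le) blast
  with A(2) show "suprank (HD_ge k n) \<le> 4 ^ k"
    by simp
qed

end
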